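(* Let $k$ be a positive integer, let $\{A_i\}_{i=1}^k$ be nonempty closed subsets of a partial metric space $(X,p)$, at least one of which is $0$-compact, and suppose that $T:\bigcup_{i=1}^k A_i\to\bigcup_{i=1}^k A_i$ satisfies the following conditions, where $A_{k+1}=A_1$: (1) $T(A_i)\subseteq A_{i+1}$ for $1\le i\le k$; (2) $p(T(x),T(y))<p(x,y)$ for all $x\in A_i$, $y\in A_{i+1}$ with $x\ne y$ and $1\le i\le k$. Then $T$ has a unique fixed point.
   Context: A partial metric space is a pair $(X,p)$ with $p:X\times X\to[0,\infty)$ such that for all $x,y,z\in X$: (P1) $p(x,y)=p(y,x)$; (P2) if $p(x,x)=p(x,y)=p(y,y)$ then $x=y$; (P3) $p(x,x)\le p(x,y)$; (P4) $p(x,z)+p(y,y)\le p(x,y)+p(y,z)$. The topology $\tau_p$ on $X$ has as base the open $p$-balls $B_p(x,\varepsilon)=\{y\in X: p(x,y)<p(x,x)+\varepsilon\}$, $x\in X$, $\varepsilon>0$; "closed" means closed with respect to $\tau_p$. A set $A\subseteq X$ is $0$-compact if for any sequence $\{x_n\}$ in $A$ there exist a subsequence $\{x_{k_n}\}$ and a point $x\in A$ such that $\lim_{n\to\infty}p(x_{k_n},x)=p(x,x)=0$. *)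

theory Defs
  imports "HOL-Analysis.Analysis"
begin

locale Partial_metric_space =
  fixes X :: "'a set" and p :: "'a \<Rightarrow> 'a \<Rightarrow> real"
  assumes nonneg: "\<lbrakk>x \<in> X; y \<in> X\<rbrakk> \<Longrightarrow> 0 \<le> p x y"
    and commute: "\<lbrakk>x \<in> X; y \<in> X\<rbrakk> \<Longrightarrow> p x y = p y x"
    and indistancy: "\<lbrakk>x \<in> X; y \<in> X; p x x = p x y; p x y = p y y\<rbrakk> \<Longrightarrow> x = y"
    and small_self: "\<lbrakk>x \<in> X; y \<in> X\<rbrakk> \<Longrightarrow> p x x \<le> p x y"
    and triangle: "\<lbrakk>x \<in> X; y \<in> X; z \<in> X\<rbrakk> \<Longrightarrow> p x z + p y y \<le> p x y + p y z"
begin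

definition pball :: "'a \<Rightarrow> real \<Rightarrow> 'a set" where
  "pball x \<epsilon> = {y \<in> X. p x y < p x x + \<epsilon>}"

definition pbase :: "'a set set" where
  "pbase = {pball x \<epsilon> |x \<epsilon>. x \<in> X \<and> \<epsilon> > 0}"

definition ptopology :: "'a topology" where
  "ptopology = topology (arbitrary union_of (\<lambda>B. B \<in> pbase))"

text \<open>The self-distance of the limit must vanish, not merely be the limit of the distances;
  for a general partial metric this is strictly stronger than convergence in the topology.\<close>

definition zero_compact :: "'a set \<Rightarrow> bool" where
  "zero_compact A \<longleftrightarrow> A \<subseteq> X \<and>
    (\<forall>\<sigma>. range \<sigma> \<subseteq> A \<longrightarrow>
      (\<exists>x\<in>A. \<exists>r :: nat \<Rightarrow> nat. strict_mono r \<and>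
        (\<lambda>n. p (\<sigma> (r n)) x) \<longlonglongrightarrow> p x x \<and> p x x = 0))"

lemma pball_subset_pball:
  assumes "x \<in> X" "y \<in> pball x \<epsilon>"
  obtains \<delta> where "\<delta> > 0" "pball y \<delta> \<subseteq> pball x \<epsilon>"
proof
  have y: "y \<in> X" "p x y < p x x + \<epsilon>"
    using assms by (auto simp: pball_def)
  show "p x x + \<epsilon> - p x y > 0"
    using y by simp
  show "pball y (p x x + \<epsilon> - p x y) \<subseteq> pball x \<epsilon>"
  proof
    fix z assume "z \<in> pball y (p x x + \<epsilon> - p x y)"
    then have "z \<in> X" "p y z < p y y + (p x x + \<epsilon> - p x y)"
      by (auto simp: pball_def)
    with triangle[OF assms(1) y(1), of z] show "z \<in> pball x \<epsilon>"
      by (simp add: pball_def)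
  qed
qed

lemma centre_in_pball: "x \<in> X \<Longrightarrow> \<epsilon> > 0 \<Longrightarrow> x \<in> pball x \<epsilon>"
  by (simp add: pball_def)

lemma pball_mono: "\<delta> \<le> \<epsilon> \<Longrightarrow> pball x \<delta> \<subseteq> pball x \<epsilon>"
  by (auto simp: pball_def)

lemma arbitrary_union_of_pbase:
  "(arbitrary union_of (\<lambda>B. B \<in> pbase)) U \<longleftrightarrow>
     U \<subseteq> X \<and> (\<forall>x\<in>U. \<exists>\<epsilon>>0. pball x \<epsilon> \<subseteq> U)"
    (is "?L \<longleftrightarrow> ?R")
proof
  assume ?L
  then have *: "\<exists>B\<in>pbase. x \<in> B \<and> B \<subseteq> U" if "x \<in> U" for x
    using that by (auto simp: arbitrary_union_of_alt)
  show ?R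
  proof (intro conjI ballI subsetI)
    show "x \<in> X" if "x \<in> U" for x
      using *[OF that] by (auto simp: pbase_def pball_def)
    show "\<exists>\<epsilon>>0. pball x \<epsilon> \<subseteq> U" if xU: "x \<in> U" for x
    proof -
      obtain y \<epsilon> where "y \<in> X" "x \<in> pball y \<epsilon>" "pball y \<epsilon> \<subseteq> U"
        using *[OF xU] by (auto simp: pbase_def)
      then show ?thesis
        by (meson pball_subset_pball subset_trans)
    qed
  qed
next
  assume R: ?R
  show ?L
    unfolding arbitrary_union_of_alt
  proof (intro ballI)
    fix x assume "x \<in> U"
    then obtain \<epsilon> where "\<epsilon> > 0" "pball x \<epsilon> \<subseteq> U" "x \<in> X"
      using R by blast
    then show "\<exists>B. B \<in> pbase \<and> x \<in> B \<and> B \<subseteq> U"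
      using centre_in_pball by (auto simp: pbase_def)
  qed
qed

lemma istopology_pbase: "istopology (arbitrary union_of (\<lambda>B. B \<in> pbase))"
  unfolding istopology_def
proof (intro conjI allI impI)
  fix S T
  assume S: "(arbitrary union_of (\<lambda>B. B \<in> pbase)) S"
    and T: "(arbitrary union_of (\<lambda>B. B \<in> pbase)) T"
  show "(arbitrary union_of (\<lambda>B. B \<in> pbase)) (S \<inter> T)"
    unfolding arbitrary_union_of_pbase
  proof (intro conjI ballI)
    show "S \<inter> T \<subseteq> X"
      using S by (auto simp: arbitrary_union_of_pbase)
    fix x assume "x \<in> S \<inter> T"
    then have "x \<in> S" "x \<in> T"
      by auto
    then obtain d e where "d > 0" "pball x d \<subseteq> S" "e > 0" "pball x e \<subseteq> T"
      using S T unfolding arbitrary_union_of_pbase by metis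
    then show "\<exists>\<epsilon>>0. pball x \<epsilon> \<subseteq> S \<inter> T"
      using pball_mono[of "min d e" d x] pball_mono[of "min d e" e x]
      by (intro exI[of _ "min d e"]) auto
  qed
next
  fix \<K>
  assume "\<forall>K\<in>\<K>. (arbitrary union_of (\<lambda>B. B \<in> pbase)) K"
  then show "(arbitrary union_of (\<lambda>B. B \<in> pbase)) (\<Union>\<K>)"
    by (intro arbitrary_union_of_Union) blast
qed

lemma openin_ptopology_base:
  "openin ptopology = arbitrary union_of (\<lambda>B. B \<in> pbase)"
  unfolding ptopology_def using istopology_pbase by (rule topology_inverse')

lemma openin_ptopology:
  "openin ptopology U \<longleftrightarrow> U \<subseteq> X \<and> (\<forall>x\<in>U. \<exists>\<epsilon>>0. pball x \<epsilon> \<subseteq> U)"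
  by (simp add: openin_ptopology_base arbitrary_union_of_pbase)

lemma topspace_ptopology [simp]: "topspace ptopology = X"
proof -
  have "openin ptopology X"
    unfolding openin_ptopology pball_def using zero_less_one by blast
  then show ?thesis
    by (metis openin_ptopology openin_subset openin_topspace subset_antisym)
qed

end

end

theory Submission
  imports Defs
begin

text \<open>
  Constant sequences show that all points of a \<open>0\<close>-compact set have self-distance \<open>0\<close>. Number the sets
  cyclically as \<open>C 0, C 1, \<dots>\<close> with \<open>C 0\<close> the \<open>0\<close>-compact one. If the orbits of two points merge before
  the \<open>k\<close>-th step, their \<open>k\<close>-th iterates agree and lie in \<open>C 0\<close>, so \<open>T ^^ k\<close> strictly decreases the
  distance of distinct points \<open>x \<in> C 0\<close>, \<open>y \<in> C 1\<close> although \<open>T\<close> need not decrease self-distances.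

  A minimising sequence for the distance between \<open>C 0\<close> and \<open>C 1\<close>, moved around the cycle so that both
  components accumulate in \<open>C 0\<close>, yields a contradiction unless \<open>C 0\<close> and \<open>C 1\<close> meet. On \<open>C 0 \<inter> C 1\<close>,
  which is \<open>0\<close>-compact, \<open>T ^^ k\<close> is strictly contractive, and Edelstein's argument gives a fixed point \<open>c\<close>
  of \<open>T ^^ k\<close>. If \<open>T c \<noteq> c\<close>, then \<open>c\<close> and \<open>T c\<close> are two fixed points of \<open>T ^^ k\<close> whose distance
  strictly decreases, which is absurd.
\<close>

section \<open>Limits, 0-compact sets and Edelstein's argument in a partial metric space\<close>

context Partial_metric_space
begin

lemma zero_compactE:
  assumes "zero_compact A" "\<And>n::nat. \<sigma> n \<in> A"
  obtains x r where "x \<in> A" "strict_mono (r :: nat \<Rightarrow> nat)" "(\<lambda>n. p (\<sigma> (r n)) x) \<longlonglongrightarrow> 0" "p x x = 0"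
  using assms unfolding zero_compact_def by (metis image_subsetI)

lemma zero_compact_subset: "zero_compact A \<Longrightarrow> A \<subseteq> X"
  by (simp add: zero_compact_def)

text \<open>\<open>small_self\<close> at both points squeezes the self-distances to 0, so
  \<open>indistancy\<close> applies.\<close>

lemma eq_if_dist_zero:
  assumes "x \<in> X" "y \<in> X" "p x y = 0"
  shows "x = y"
  by (metis assms commute indistancy nonneg order_antisym small_self)

lemma zero_compact_self_dist:
  assumes "zero_compact A" "x \<in> A"
  shows "p x x = 0"
proof -
  obtain y and r :: "nat \<Rightarrow> nat" where y: "y \<in> A" "(\<lambda>n. p x y) \<longlonglongrightarrow> 0" "p y y = 0"
    by (rule zero_compactE[OF assms(1), of "\<lambda>_. x"]) (use assms in auto)
  then have "p x y = 0"
    by (simp add: LIMSEQ_const_iff)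
  with y show ?thesis
    using eq_if_dist_zero[of x y] assms zero_compact_subset by blast
qed

lemma triangle_weak: "\<lbrakk>x \<in> X; y \<in> X; z \<in> X\<rbrakk> \<Longrightarrow> p x z \<le> p x y + p y z"
  using triangle[of x y z] nonneg[of y y] by linarith

lemma closedin_limit:
  assumes "closedin ptopology B" "\<And>n::nat. \<sigma> n \<in> B" "x \<in> X"
    and lim: "(\<lambda>n. p (\<sigma> n) x) \<longlonglongrightarrow> p x x"
  shows "x \<in> B"
proof (rule ccontr)
  assume "x \<notin> B"
  have "B \<subseteq> X" and op: "openin ptopology (X - B)"
    using assms(1) by (auto simp: closedin_def)
  then obtain \<epsilon> where \<epsilon>: "\<epsilon> > 0" "pball x \<epsilon> \<subseteq> X - B"
    using \<open>x \<notin> B\<close> \<open>x \<in> X\<close> unfolding openin_ptopology by blast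
  from \<epsilon> have "\<forall>\<^sub>F n in sequentially. p (\<sigma> n) x < p x x + \<epsilon>"
    by (intro order_tendstoD(2)[OF lim]) auto
  then obtain n where "p (\<sigma> n) x < p x x + \<epsilon>"
    by (auto simp: eventually_sequentially)
  then have "\<sigma> n \<in> pball x \<epsilon>"
    using assms(2,3) \<open>B \<subseteq> X\<close> commute[of "\<sigma> n" x] by (auto simp: pball_def subset_iff)
  with \<epsilon> assms(2) show False by blast
qed

text \<open>The subsequential limit in \<open>A\<close> has self-distance 0, so it is a limit in the
  topology as well and stays in \<open>B\<close>.\<close>

lemma zero_compact_Int_closedin:
  assumes "zero_compact A" "closedin ptopology B"
  shows "zero_compact (A \<inter> B)"
  unfolding zero_compact_def
proof (intro conjI allI impI)
  show "A \<inter> B \<subseteq> X"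
    using zero_compact_subset[OF assms(1)] by blast
  fix \<sigma> :: "nat \<Rightarrow> 'a" assume \<sigma>: "range \<sigma> \<subseteq> A \<inter> B"
  then obtain x and r :: "nat \<Rightarrow> nat"
    where x: "x \<in> A" "strict_mono r" "(\<lambda>n. p (\<sigma> (r n)) x) \<longlonglongrightarrow> 0" "p x x = 0"
    by (metis zero_compactE[OF assms(1), of \<sigma>] Int_iff range_subsetD)
  then have "x \<in> B"
    using closedin_limit[OF assms(2), of "\<lambda>n. \<sigma> (r n)" x] \<sigma> zero_compact_subset[OF assms(1)]
    by (auto simp: image_subset_iff)
  with x show "\<exists>x\<in>A \<inter> B. \<exists>r. strict_mono r \<and> (\<lambda>n. p (\<sigma> (r n)) x) \<longlonglongrightarrow> p x x \<and> p x x = 0"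
    by (metis IntI)
qed

text \<open>The displacement \<open>p x (S x)\<close> attains its infimum on \<open>B\<close>. If a
  minimiser were not fixed, passing to its image would lower the displacement.\<close>

lemma zero_compact_Edelstein:
  assumes B: "zero_compact B" "B \<noteq> {}" and S: "\<And>x. x \<in> B \<Longrightarrow> S x \<in> B"
    and contr: "\<And>x y. \<lbrakk>x \<in> B; y \<in> B; x \<noteq> y\<rbrakk> \<Longrightarrow> p (S x) (S y) < p x y"
  shows "\<exists>x\<in>B. S x = x"
proof (rule ccontr)
  assume nofix: "\<not> ?thesis"
  define V where "V = (\<lambda>x. p x (S x)) ` B"
  have BX: "x \<in> X" if "x \<in> B" for x
    using that B zero_compact_subset by blast
  have "V \<noteq> {}" "bdd_below V"
    using B BX S nonneg by (auto simp: V_def intro!: bdd_belowI[of _ 0])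
  then obtain v where v: "\<And>n::nat. v n \<in> V" "v \<longlonglongrightarrow> Inf V"
    using closure_contains_Inf[of V] by (auto simp: closure_sequential)
  then obtain \<sigma> where \<sigma>: "\<And>n. \<sigma> n \<in> B" "\<And>n. v n = p (\<sigma> n) (S (\<sigma> n))"
    unfolding V_def image_iff by metis
  obtain x and r :: "nat \<Rightarrow> nat"
    where x: "x \<in> B" "strict_mono r" "(\<lambda>n. p (\<sigma> (r n)) x) \<longlonglongrightarrow> 0" "p x x = 0"
    using zero_compactE[OF B(1), of \<sigma>] \<sigma>(1) by blast
  have "p x (S x) \<le> p (\<sigma> (r n)) x + v (r n) + p (\<sigma> (r n)) x" for n
  proof -
    let ?y = "\<sigma> (r n)"
    have y: "?y \<in> B" using \<sigma> by blast
    \<comment> \<open>If \<open>?y = x\<close>, then \<open>contr\<close> says nothing, but both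
      sides are self-distances in \<open>B\<close>, hence 0.\<close>
    have "p (S ?y) (S x) \<le> p ?y x"
      using contr[OF y x(1)] zero_compact_self_dist[OF B(1)] S y x by (cases "?y = x") fastforce+
    then show ?thesis
      using triangle_weak[of x ?y "S x"] triangle_weak[of ?y "S ?y" "S x"] commute[of x ?y]
        BX S x y \<sigma>(2)[of "r n"] by fastforce
  qed
  moreover have "(\<lambda>n. p (\<sigma> (r n)) x + v (r n) + p (\<sigma> (r n)) x) \<longlonglongrightarrow> 0 + Inf V + 0"
    by (intro tendsto_add x LIMSEQ_subseq_LIMSEQ[OF v(2) x(2), unfolded comp_def])
  ultimately have "p x (S x) \<le> Inf V"
    using LIMSEQ_le_const by fastforce
  moreover have "p (S x) (S (S x)) < p x (S x)"
    using contr nofix S x by metis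
  moreover have "Inf V \<le> p (S x) (S (S x))"
    using \<open>bdd_below V\<close> S x(1) by (auto simp: V_def intro: cInf_lower)
  ultimately show False by linarith
qed

end

text \<open>Indexing the cycle by all naturals with period \<open>k\<close> removes the wrap-around
  case from the orbit arguments.\<close>

locale cyclic_contraction = Partial_metric_space +
  fixes C :: "nat \<Rightarrow> 'a set" and T :: "'a \<Rightarrow> 'a" and k :: nat
  assumes k: "k \<ge> 1" and C_subset: "C i \<subseteq> X" and C_add_period: "C (i + k) = C i"
    and T_in: "x \<in> C i \<Longrightarrow> T x \<in> C (Suc i)"
    and contractive: "\<lbrakk>x \<in> C i; y \<in> C (Suc i); x \<noteq> y\<rbrakk> \<Longrightarrow> p (T x) (T y) < p x y"
begin

lemma funpow_in: "x \<in> C i \<Longrightarrow> (T ^^ n) x \<in> C (i + n)"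
  by (induction n) (auto intro: T_in)

text \<open>Orbits that have met stay equal, but their distance is then a self-distance, which need
  not be small; hence the disjunction.\<close>

lemma funpow_dist_less_or_eq:
  assumes "x \<in> C i" "y \<in> C (Suc i)" "x \<noteq> y"
  shows "(T ^^ Suc n) x = (T ^^ Suc n) y \<or> p ((T ^^ Suc n) x) ((T ^^ Suc n) y) < p x y"
proof (induction n)
  case 0
  then show ?case using contractive[OF assms] by simp
next
  case (Suc n)
  then show ?case
    using contractive[of "(T ^^ Suc n) x" "i + Suc n" "(T ^^ Suc n) y"]
      funpow_in[OF assms(1), of "Suc n"] funpow_in[OF assms(2), of "Suc n"]
    by (cases "(T ^^ Suc n) x = (T ^^ Suc n) y") auto
qed

lemma fixed_point_unique:
  assumes "x \<in> C i" "T x = x" "y \<in> C j" "T y = y"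
  shows "x = y"
proof (rule ccontr)
  assume "x \<noteq> y"
  have pow: "(T ^^ n) z = z" if "T z = z" for n z
    using that by (induction n) auto
  \<comment> \<open>Fixed points travel along the cycle: \<open>j\<close> steps for \<open>x\<close>
    and \<open>Suc i\<close> steps for \<open>y\<close> put them in consecutive sets.\<close>
  have "x \<in> C (i + j)" "y \<in> C (Suc (i + j))"
    using funpow_in[OF assms(1), of j] funpow_in[OF assms(3), of "Suc i"] pow assms
    by (simp_all add: add.commute del: funpow.simps)
  with contractive[OF this \<open>x \<noteq> y\<close>] assms show False by simp
qed

section \<open>Existence of a fixed point when \<open>C 0\<close> is 0-compact\<close>

context
  assumes compact: "zero_compact (C 0)" and nonempty: "C 0 \<noteq> {}" and closed: "closedin ptopology (C 1)"
begin

lemma period_contractive: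
  assumes "x \<in> C 0" "y \<in> C 1" "x \<noteq> y"
  shows "p ((T ^^ k) x) ((T ^^ k) y) < p x y"
proof -
  have "(T ^^ k) x = (T ^^ k) y \<or> p ((T ^^ k) x) ((T ^^ k) y) < p x y"
    using funpow_dist_less_or_eq[of x 0 y "k - 1"] assms k by simp
  moreover have "p ((T ^^ k) x) ((T ^^ k) x) = 0"
    using zero_compact_self_dist[OF compact] funpow_in[OF assms(1), of k] C_add_period[of 0] by simp
  moreover have "0 < p x y"
    using eq_if_dist_zero[of x y] nonneg[of x y] assms C_subset by fastforce
  ultimately show ?thesis by auto
qed

text \<open>The iterate of \<open>y\<close> lies in \<open>C k = C 0\<close>, so merged orbits are
  at distance 0. For \<open>k = 1\<close> the iterate is the identity, so the inequality cannot be
  strict.\<close>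

lemma pred_period_nonexpansive:
  assumes "x \<in> C 0" "y \<in> C 1"
  shows "p ((T ^^ (k - 1)) x) ((T ^^ (k - 1)) y) \<le> p x y"
proof -
  have "(T ^^ (k - 1)) x = (T ^^ (k - 1)) y \<or> p ((T ^^ (k - 1)) x) ((T ^^ (k - 1)) y) \<le> p x y"
  proof (cases "x = y \<or> k = 1")
    case False
    with k funpow_dist_less_or_eq[of x 0 y "k - 2"] assms show ?thesis
      by (auto simp: numeral_2_eq_2 Suc_diff_Suc less_eq_real_def simp del: funpow.simps)
  qed auto
  moreover have "p ((T ^^ (k - 1)) y) ((T ^^ (k - 1)) y) = 0"
    using zero_compact_self_dist[OF compact] funpow_in[OF assms(2), of "k - 1"] k C_add_period[of 0]
    by simp
  moreover have "0 \<le> p x y"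
    using nonneg assms C_subset by blast
  ultimately show ?thesis by auto
qed

lemma Int_nonempty: "C 0 \<inter> C 1 \<noteq> {}"
proof -
  define V where "V = (\<lambda>(x, y). p x y) ` (C 0 \<times> C 1)"
  have CX: "x \<in> X" if "x \<in> C i" for x i
    using that C_subset by blast
  have per: "C k = C 0" "C (Suc k) = C 1"
    using C_add_period[of 0] C_add_period[of 1] by simp_all
  have "V \<noteq> {}" "bdd_below V"
    using nonempty T_in[of _ 0] CX nonneg by (auto simp: V_def intro!: bdd_belowI[of _ 0])
  then obtain v where v: "\<And>n::nat. v n \<in> V" "v \<longlonglongrightarrow> Inf V"
    using closure_contains_Inf[of V] by (auto simp: closure_sequential)
  have "\<exists>x y. x \<in> C 0 \<and> y \<in> C 1 \<and> v n = p x y" for n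
    using v(1)[of n] by (auto simp: V_def)
  then obtain \<sigma> \<tau> where st: "\<And>n. \<sigma> n \<in> C 0" "\<And>n. \<tau> n \<in> C 1" "\<And>n. v n = p (\<sigma> n) (\<tau> n)"
    by metis
  obtain a and r :: "nat \<Rightarrow> nat"
    where a: "a \<in> C 0" "strict_mono r" "(\<lambda>n. p (\<sigma> (r n)) a) \<longlonglongrightarrow> 0" "p a a = 0"
    using zero_compactE[OF compact, of \<sigma>] st(1) by blast
  \<comment> \<open>By periodicity \<open>?U\<close> carries \<open>C 1\<close> into
    \<open>C 0\<close>, where the moved second components have a convergent subsequence.\<close>
  let ?U = "T ^^ (k - 1)"
  have U: "?U y \<in> C 0" if "y \<in> C 1" for y
    using funpow_in[OF that, of "k - 1"] k per by simp
  obtain b and s :: "nat \<Rightarrow> nat"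
    where b: "b \<in> C 0" "strict_mono s" "(\<lambda>n. p (?U (\<tau> (r (s n)))) b) \<longlonglongrightarrow> 0" "p b b = 0"
    using zero_compactE[OF compact, of "\<lambda>n. ?U (\<tau> (r n))"] U st(2) by blast
  have Ua: "?U a \<in> C (k - 1)"
    using funpow_in[OF a(1), of "k - 1"] by simp
  have "p (?U a) b \<le> p (\<sigma> (r (s n))) a + v (r (s n)) + p (?U (\<tau> (r (s n)))) b" for n
  proof -
    let ?x = "\<sigma> (r (s n))" and ?y = "\<tau> (r (s n))"
    have xy: "?x \<in> C 0" "?y \<in> C 1" using st by auto
    have "p (?U a) b \<le> p (?U a) (?U ?y) + p (?U ?y) b"
      using triangle_weak CX Ua U b xy by blast
    moreover have "p (?U a) (?U ?y) \<le> p a ?y"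
      using pred_period_nonexpansive a xy by blast
    moreover have "p a ?y \<le> p a ?x + p ?x ?y"
      using triangle_weak CX a xy by blast
    ultimately show ?thesis
      using commute[of a ?x] CX a(1) xy st(3)[of "r (s n)"] by fastforce
  qed
  moreover have "(\<lambda>n. p (\<sigma> (r (s n))) a + v (r (s n)) + p (?U (\<tau> (r (s n)))) b) \<longlonglongrightarrow> 0 + Inf V + 0"
    using LIMSEQ_subseq_LIMSEQ[OF a(3) b(2)] LIMSEQ_subseq_LIMSEQ[OF v(2) strict_mono_o[OF a(2) b(2)]]
    by (intro tendsto_add b(3)) (simp_all add: comp_def)
  ultimately have le: "p (?U a) b \<le> Inf V"
    using LIMSEQ_le_const by fastforce
  \<comment> \<open>Now \<open>?U a\<close> and \<open>b\<close> lie in consecutive sets. One more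
    step leads to \<open>C 0\<close> and \<open>C 1\<close>, either below the infimum or, if
    \<open>?U a = b\<close>, to a common point.\<close>
  have bk: "b \<in> C (Suc (k - 1))"
    using b(1) k per by simp
  have Tb: "T b \<in> C 1"
    using T_in[OF b(1)] by simp
  have TUa: "T (?U a) \<in> C 0"
    using T_in[OF Ua] k per by simp
  show ?thesis
  proof (cases "?U a = b")
    case True
    with TUa Tb show ?thesis by auto
  next
    case False
    have "p (T (?U a)) (T b) < Inf V"
      using contractive[OF Ua bk False] le by simp
    moreover have "Inf V \<le> p (T (?U a)) (T b)"
      using \<open>bdd_below V\<close> TUa Tb by (force simp: V_def intro: cInf_lower)
    ultimately show ?thesis by simp
  qed
qed

lemma fixed_point_exists: "\<exists>x\<in>C 0. T x = x"
proof -
  have per: "C k = C 0" "C (Suc k) = C 1"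
    using C_add_period[of 0] C_add_period[of 1] by simp_all
  have "\<exists>c\<in>C 0 \<inter> C 1. (T ^^ k) c = c"
  proof (rule zero_compact_Edelstein)
    show "zero_compact (C 0 \<inter> C 1)"
      by (rule zero_compact_Int_closedin[OF compact closed])
    show "(T ^^ k) x \<in> C 0 \<inter> C 1" if "x \<in> C 0 \<inter> C 1" for x
      using that funpow_in[of x 0 k] funpow_in[of x 1 k] per by simp
  qed (use Int_nonempty period_contractive in auto)
  then obtain c where c: "c \<in> C 0" "(T ^^ k) c = c"
    by blast
  then have "(T ^^ k) (T c) = T c"
    by (metis funpow_swap1)
  then have "T c = c"
    using period_contractive[of c "T c"] c T_in[OF c(1)] by force
  with c show ?thesis by blast
qed

end

end

section \<open>Passage from the given sets to a periodic sequence\<close>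

theorem theorem6:
  fixes X :: "'a set" and p :: "'a \<Rightarrow> 'a \<Rightarrow> real"
    and k :: nat and A :: "nat \<Rightarrow> 'a set" and T :: "'a \<Rightarrow> 'a"
  assumes "Partial_metric_space X p"
    and "k \<ge> 1"
    and "\<And>i. i \<in> {1..k} \<Longrightarrow> A i \<noteq> {}"
    and "\<And>i. i \<in> {1..k} \<Longrightarrow> closedin (Partial_metric_space.ptopology X p) (A i)"
    and "\<exists>i\<in>{1..k}. Partial_metric_space.zero_compact X p (A i)"
    and "A (k + 1) = A 1"
    and "T \<in> (\<Union>i\<in>{1..k}. A i) \<rightarrow> (\<Union>i\<in>{1..k}. A i)"
    and "\<And>i. i \<in> {1..k} \<Longrightarrow> T ` A i \<subseteq> A (i + 1)"
    and "\<And>i x y. \<lbrakk>i \<in> {1..k}; x \<in> A i; y \<in> A (i + 1); x \<noteq> y\<rbrakk> \<Longrightarrow> p (T x) (T y) < p x y"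
  shows "\<exists>!x. x \<in> (\<Union>i\<in>{1..k}. A i) \<and> T x = x"
proof -
  interpret Partial_metric_space X p by fact
  obtain m where m: "m \<in> {1..k}" "zero_compact (A m)"
    using assms(5) by blast
  \<comment> \<open>The residue counts from 0 and \<open>Suc\<close> returns it to
    \<open>{1..k}\<close>; the offset \<open>m - 1\<close> makes \<open>C 0\<close> the 0-compact
    set.\<close>
  define C where "C j = A (Suc ((m - 1 + j) mod k))" for j
  have idx: "Suc (i mod k) \<in> {1..k}" for i
    using assms(2) by (auto simp: Suc_le_eq)
  have next_A: "A (Suc (i mod k) + 1) = A (Suc (Suc i mod k))" for i
    using assms(2,6) by (auto simp: mod_Suc)
  have "(m - 1) mod k = m - 1"
    using m(1) by (intro mod_less) auto
  then have C0: "C 0 = A m"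
    using m(1) by (simp add: C_def)
  interpret cyclic_contraction X p C T k
  proof
    show "1 \<le> k" by fact
    show "C i \<subseteq> X" for i
      using closedin_subset[OF assms(4)[OF idx]] by (simp add: C_def)
    show "C (i + k) = C i" for i
      by (simp add: C_def flip: add.assoc)
    show "T x \<in> C (Suc i)" if "x \<in> C i" for x i
      using assms(8)[OF idx[of "m - 1 + i"]] that
      unfolding C_def next_A add_Suc_right by blast
    show "p (T x) (T y) < p x y" if "x \<in> C i" "y \<in> C (Suc i)" "x \<noteq> y" for x y i
      using assms(9)[OF idx[of "m - 1 + i"], of x y] that
      unfolding C_def next_A add_Suc_right by blast
  qed
  have ex: "\<exists>x\<in>C 0. T x = x"
  proof (rule fixed_point_exists)
    show "zero_compact (C 0)" "C 0 \<noteq> {}"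
      using m assms(3) by (simp_all add: C0)
    show "closedin ptopology (C 1)"
      unfolding C_def by (rule assms(4)[OF idx])
  qed
  have A_C: "\<exists>j. A i = C j" if "i \<in> {1..k}" for i
  proof
    \<comment> \<open>Adding \<open>k\<close> before subtracting \<open>m - 1\<close> keeps the
      natural-number subtraction from truncating.\<close>
    have "m - 1 + (i - 1 + (k - (m - 1))) = i - 1 + k"
      using m(1) by auto
    moreover have "(i - 1) mod k = i - 1" "Suc (i - 1) = i"
      using that by (auto intro!: mod_less)
    ultimately show "A i = C (i - 1 + (k - (m - 1)))"
      unfolding C_def by (metis mod_add_self2)
  qed
  show ?thesis
  proof (rule ex_ex1I)
    show "\<exists>x. x \<in> (\<Union>i\<in>{1..k}. A i) \<and> T x = x"
      using ex m(1) unfolding C0 by blast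
    show "x = y" if "x \<in> (\<Union>i\<in>{1..k}. A i) \<and> T x = x" "y \<in> (\<Union>i\<in>{1..k}. A i) \<and> T y = y" for x y
      using that A_C by (elim conjE UN_E) (metis fixed_point_unique)
  qed
qed

end
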